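(* If $G$ is a connected unit interval graph with minimum degree $\delta(G) \geq 2$, then $rc(G) = diam(G)$.
   Context: A unit interval graph is an intersection graph of unit-length intervals on the real line. An edge-coloured graph is rainbow connected if every pair of vertices is joined by a path no two of whose edges have the same colour; $rc(G)$ is the minimum number of colours in an edge colouring making the connected graph $G$ rainbow connected. $diam(G)$ is the maximum distance between two vertices. *)

theory Defs
  imports Complex_Main
begin

text \<open>
  A graph is a vertex set \<open>V\<close> together with a set \<open>E\<close> of edges, each edge being the
  two-element set of its end vertices. A path is given by its nonempty list of pairwise distinct
  vertices; the one-vertex list is the path of length 0.
\<close>

definition simple_graph :: "'a set \<Rightarrow> 'a set set \<Rightarrow> bool" where
  "simple_graph V E \<longleftrightarrow> finite V \<and> (\<forall>e\<in>E. e \<subseteq> V \<and> card e = 2)"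

definition path_between :: "'a set \<Rightarrow> 'a set set \<Rightarrow> 'a \<Rightarrow> 'a list \<Rightarrow> 'a \<Rightarrow> bool" where
  "path_between V E u p v \<longleftrightarrow>
     p \<noteq> [] \<and> hd p = u \<and> last p = v \<and> set p \<subseteq> V \<and> distinct p \<and>
     successively (\<lambda>x y. {x, y} \<in> E) p"

definition path_edges :: "'a list \<Rightarrow> 'a set list" where
  "path_edges p = map2 (\<lambda>x y. {x, y}) p (tl p)"

definition connected_graph :: "'a set \<Rightarrow> 'a set set \<Rightarrow> bool" where
  "connected_graph V E \<longleftrightarrow> V \<noteq> {} \<and> (\<forall>u\<in>V. \<forall>v\<in>V. \<exists>p. path_between V E u p v)"

text \<open>The distance and the diameter are meaningful only for finite connected graphs.\<close>

definition graph_distance :: "'a set \<Rightarrow> 'a set set \<Rightarrow> 'a \<Rightarrow> 'a \<Rightarrow> nat" where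
  "graph_distance V E u v = (LEAST n. \<exists>p. path_between V E u p v \<and> length (path_edges p) = n)"

definition graph_diameter :: "'a set \<Rightarrow> 'a set set \<Rightarrow> nat" where
  "graph_diameter V E = Max {graph_distance V E u v | u v. u \<in> V \<and> v \<in> V}"

definition vertex_degree :: "'a set set \<Rightarrow> 'a \<Rightarrow> nat" where
  "vertex_degree E v = card {e \<in> E. v \<in> e}"

definition minimum_degree :: "'a set \<Rightarrow> 'a set set \<Rightarrow> nat" where
  "minimum_degree V E = Min (vertex_degree E ` V)"

text \<open>
  Unit intervals are taken to be closed, \<open>l v\<close> being the left end point of the interval of \<open>v\<close>.
  Distinct vertices may be represented by the same interval.
\<close>

definition unit_interval_graph :: "'a set \<Rightarrow> 'a set set \<Rightarrow> bool" where
  "unit_interval_graph V E \<longleftrightarrow> simple_graph V E \<and>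
     (\<exists>l :: 'a \<Rightarrow> real. \<forall>u\<in>V. \<forall>v\<in>V. u \<noteq> v \<longrightarrow>
        ({u, v} \<in> E \<longleftrightarrow> {l u..l u + 1} \<inter> {l v..l v + 1} \<noteq> {}))"

text \<open>
  An edge colouring is an arbitrary function on edges: adjacent edges may share a colour. Only its
  values on \<open>E\<close> matter, and the number of colours it uses is \<open>card (c ` E)\<close>.
\<close>

definition rainbow_connected :: "'a set \<Rightarrow> 'a set set \<Rightarrow> ('a set \<Rightarrow> nat) \<Rightarrow> bool" where
  "rainbow_connected V E c \<longleftrightarrow>
     (\<forall>u\<in>V. \<forall>v\<in>V. \<exists>p. path_between V E u p v \<and> distinct (map c (path_edges p)))"

definition rainbow_connection_number :: "'a set \<Rightarrow> 'a set set \<Rightarrow> nat" where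
  "rainbow_connection_number V E =
     (LEAST k. \<exists>c. rainbow_connected V E c \<and> card (c ` E) = k)"

end

theory Submission
  imports Defs
begin

text \<open>
  Start at a leftmost vertex and always jump to the rightmost neighbour; this gives anchors
  \<open>A\<^sub>0, A\<^sub>1, A\<^sub>2, \<dots>\<close>. The vertices lying between \<open>A\<^sub>i\<close> and \<open>A\<^sub>i\<^sub>+\<^sub>1\<close> form a clique, and by greediness
  a vertex at distance \<open>m\<close> from \<open>A\<^sub>0\<close> lies weakly left of \<open>A\<^sub>m\<close>, so as many cliques as the diameter
  cover the graph. Give the edges of the \<open>i\<close>-th clique colour \<open>i\<close>: a path that enters the anchor
  sequence, follows it and leaves it again meets every clique at most once and so is rainbow.
\<close>

section \<open>Edge lists of paths and path reversal\<close>

lemma length_path_edges: "length (path_edges p) = length p - 1"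
  by (simp add: path_edges_def)

lemma path_edges_Nil [simp]: "path_edges [] = []"
  by (simp add: path_edges_def)

lemma path_edges_single [simp]: "path_edges [x] = []"
  by (simp add: path_edges_def)

lemma path_edges_Cons: "p \<noteq> [] \<Longrightarrow> path_edges (x # p) = {x, hd p} # path_edges p"
  by (cases p) (auto simp: path_edges_def)

lemma path_edges_subset:
  assumes "successively (\<lambda>x y. {x, y} \<in> E) p"
  shows "set (path_edges p) \<subseteq> E"
  using assms
proof (induction p)
  case Nil
  then show ?case by simp
next
  case (Cons x p)
  then show ?case
    by (cases "p = []") (auto simp: path_edges_Cons successively_Cons)
qed

lemma path_between_rev:
  assumes "path_between V E u p v"
  shows "path_between V E v (rev p) u"
  using assms by (auto simp: path_between_def hd_rev last_rev insert_commute)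

lemma path_edges_append_single:
  "p \<noteq> [] \<Longrightarrow> path_edges (p @ [x]) = path_edges p @ [{last p, x}]"
  by (induction p rule: list_nonempty_induct) (simp_all add: path_edges_Cons)

lemma path_edges_rev: "path_edges (rev p) = rev (path_edges p)"
proof (induction p)
  case (Cons x p)
  then show ?case
    by (cases "p = []") (auto simp: path_edges_Cons path_edges_append_single last_rev
        insert_commute)
qed simp

section \<open>Distance, diameter and the lower bound for the number of colours\<close>

lemma graph_distance_le:
  "path_between V E u p v \<Longrightarrow> graph_distance V E u v \<le> length (path_edges p)"
  unfolding graph_distance_def by (rule Least_le) blast

lemma shortest_path_exists:
  assumes "path_between V E u p v"
  shows "\<exists>q. path_between V E u q v \<and> length (path_edges q) = graph_distance V E u v"
  unfolding graph_distance_def by (rule LeastI_ex) (use assms in blast)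

lemma finite_graph_distances:
  "finite V \<Longrightarrow> finite {graph_distance V E u v | u v. u \<in> V \<and> v \<in> V}"
  by (rule finite_image_set2) auto

lemma graph_distance_le_diameter:
  assumes "finite V" "u \<in> V" "v \<in> V"
  shows "graph_distance V E u v \<le> graph_diameter V E"
  unfolding graph_diameter_def
  by (rule Max_ge[OF finite_graph_distances]) (use assms in auto)

lemma graph_diameter_attained:
  assumes "finite V" "V \<noteq> {}"
  obtains u v where "u \<in> V" "v \<in> V" "graph_diameter V E = graph_distance V E u v"
proof -
  have "graph_diameter V E \<in> {graph_distance V E u v | u v. u \<in> V \<and> v \<in> V}"
    unfolding graph_diameter_def
    by (rule Max_in[OF finite_graph_distances]) (use assms in auto)
  with that show thesis by blast
qed

lemma simple_graph_finite_edges: "simple_graph V E \<Longrightarrow> finite E"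
  unfolding simple_graph_def by (meson PowI finite_Pow_iff finite_subset subsetI)

text \<open>A rainbow path joining two vertices at maximum distance has at least as many edges as
  the diameter, and all their colours differ.\<close>

lemma graph_diameter_le_card_colours:
  assumes "simple_graph V E" "V \<noteq> {}" "rainbow_connected V E c"
  shows "graph_diameter V E \<le> card (c ` E)"
proof -
  have "finite V" using assms(1) by (simp add: simple_graph_def)
  then obtain u v where uv: "u \<in> V" "v \<in> V" "graph_diameter V E = graph_distance V E u v"
    using graph_diameter_attained assms(2) by metis
  then obtain p where p: "path_between V E u p v" "distinct (map c (path_edges p))"
    using assms(3) unfolding rainbow_connected_def by blast
  have "graph_distance V E u v \<le> length (map c (path_edges p))"
    using graph_distance_le[OF p(1)] by simp
  also have "\<dots> = card (c ` set (path_edges p))"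
    using distinct_card[OF p(2)] by simp
  also have "\<dots> \<le> card (c ` E)"
    using p(1) path_edges_subset simple_graph_finite_edges[OF assms(1)]
    unfolding path_between_def by (intro card_mono) auto
  finally show ?thesis using uv(3) by simp
qed

lemma rainbow_connection_number_eqI:
  assumes "simple_graph V E" "V \<noteq> {}" "rainbow_connected V E c"
    and "card (c ` E) \<le> graph_diameter V E"
  shows "rainbow_connection_number V E = graph_diameter V E"
  unfolding rainbow_connection_number_def
proof (rule Least_equality)
  show "\<exists>c. rainbow_connected V E c \<and> card (c ` E) = graph_diameter V E"
    using assms graph_diameter_le_card_colours by (metis le_antisym)
qed (use assms graph_diameter_le_card_colours in blast)

section \<open>Greedy anchors in a unit interval model\<close>

locale unit_interval_model =
  fixes V :: "'a set" and E :: "'a set set" and l :: "'a \<Rightarrow> real"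
  assumes simple: "simple_graph V E"
    and connected: "connected_graph V E"
    and edge_iff: "\<And>u v. u \<in> V \<Longrightarrow> v \<in> V \<Longrightarrow> u \<noteq> v \<Longrightarrow> {u, v} \<in> E \<longleftrightarrow> \<bar>l u - l v\<bar> \<le> 1"
begin

lemma finite_V: "finite V"
  using simple by (simp add: simple_graph_def)

lemma V_nonempty: "V \<noteq> {}"
  using connected by (simp add: connected_graph_def)

text \<open>Minimising \<open>- l v\<close> picks a rightmost vertex. The candidates include
  \<open>anchor i\<close> and everything to its left, so there always is one, and the position stays
  fixed once no further progress is possible.\<close>

primrec anchor :: "nat \<Rightarrow> 'a" where
  "anchor 0 = arg_min_on l V"
| "anchor (Suc i) = arg_min_on (\<lambda>v. - l v) {v \<in> V. l v \<le> l (anchor i) + 1}"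

lemma anchor_0_in: "anchor 0 \<in> V"
  using arg_min_if_finite(1)[OF finite_V V_nonempty] by simp

lemma anchor_0_le: "v \<in> V \<Longrightarrow> l (anchor 0) \<le> l v"
  using arg_min_least[OF finite_V V_nonempty] by simp

lemma anchor_in_V: "anchor i \<in> V"
proof (induction i)
  case 0
  show ?case by (rule anchor_0_in)
next
  case (Suc i)
  then have "{v \<in> V. l v \<le> l (anchor i) + 1} \<noteq> {}" by auto
  from arg_min_if_finite(1)[OF _ this, of "\<lambda>v. - l v"] show ?case
    using finite_V by simp
qed

lemma anchor_Suc_le: "l (anchor (Suc i)) \<le> l (anchor i) + 1"
proof -
  have "{v \<in> V. l v \<le> l (anchor i) + 1} \<noteq> {}" using anchor_in_V[of i] by auto
  from arg_min_if_finite(1)[OF _ this, of "\<lambda>v. - l v"] show ?thesis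
    using finite_V by simp
qed

lemma le_anchor_Suc:
  assumes "v \<in> V" "l v \<le> l (anchor i) + 1"
  shows "l v \<le> l (anchor (Suc i))"
proof -
  have "v \<in> {v \<in> V. l v \<le> l (anchor i) + 1}" using assms by simp
  from arg_min_least[OF _ _ this, of "\<lambda>v. - l v"] this show ?thesis
    using finite_V by fastforce
qed

declare anchor.simps [simp del]

lemma anchor_mono: "i \<le> j \<Longrightarrow> l (anchor i) \<le> l (anchor j)"
  by (rule lift_Suc_mono_le[of "\<lambda>i. l (anchor i)"]) (auto intro!: le_anchor_Suc anchor_in_V)

lemma anchor_stationary:
  assumes "l (anchor (Suc i)) \<le> l (anchor i)" "i \<le> k"
  shows "l (anchor k) \<le> l (anchor i)"
  using assms(2)
proof (induction k rule: dec_induct)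
  case (step k)
  then have "l (anchor (Suc k)) \<le> l (anchor i) + 1"
    using anchor_Suc_le[of k] by simp
  from le_anchor_Suc[OF anchor_in_V this] assms(1) show ?case by linarith
qed simp

text \<open>An edge advances by at most 1, and the greedy jump goes as far right as any vertex
  within that range. So a path that starts no further right than an anchor never overtakes the
  anchors; \<open>length p - 1\<close> counts its edges.\<close>

lemma walk_le_anchor:
  assumes "successively (\<lambda>x y. {x, y} \<in> E) p" "set p \<subseteq> V" "distinct p" "p \<noteq> []"
    and "l (hd p) \<le> l (anchor i)"
  shows "l (last p) \<le> l (anchor (i + length p - 1))"
  using assms
proof (induction p arbitrary: i)
  case (Cons x p)
  show ?case
  proof (cases "p = []")
    case False
    then have "hd p \<in> V" "x \<in> V" "x \<noteq> hd p" "{x, hd p} \<in> E"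
      using Cons.prems by (auto simp: successively_Cons)
    then have "l (hd p) \<le> l (anchor i) + 1"
      using edge_iff[of x "hd p"] Cons.prems(5) by auto
    then have "l (hd p) \<le> l (anchor (Suc i))"
      using le_anchor_Suc \<open>hd p \<in> V\<close> by blast
    then show ?thesis
      using Cons.IH[of "Suc i"] Cons.prems False by (simp add: successively_Cons)
  qed (use Cons.prems in auto)
qed simp

lemma le_anchor_diameter:
  assumes "v \<in> V"
  shows "l v \<le> l (anchor (graph_diameter V E))"
proof -
  obtain p where p: "path_between V E (anchor 0) p v"
    and len: "length (path_edges p) = graph_distance V E (anchor 0) v"
    using connected anchor_0_in assms shortest_path_exists
    unfolding connected_graph_def by metis
  have "l v \<le> l (anchor (length (path_edges p)))"
    using walk_le_anchor[of p 0] p by (auto simp: path_between_def length_path_edges)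
  also have "\<dots> \<le> l (anchor (graph_diameter V E))"
    using graph_distance_le_diameter[OF finite_V anchor_0_in assms] len
    by (intro anchor_mono) simp
  finally show ?thesis .
qed

section \<open>Levels: the partition of the vertices into cliques\<close>

text \<open>Level \<open>i\<close> collects the positions after \<open>anchor i\<close> up to and
  including \<open>anchor (Suc i)\<close>; level 0 also contains the position of
  \<open>anchor 0\<close>.\<close>

definition level :: "'a \<Rightarrow> nat" where
  "level v = (LEAST i. l v \<le> l (anchor (Suc i)))"

lemma le_anchor_Suc_level:
  assumes "v \<in> V"
  shows "l v \<le> l (anchor (Suc (level v)))"
  unfolding level_def
proof (rule LeastI)
  show "l v \<le> l (anchor (Suc (graph_diameter V E)))"
    using le_anchor_diameter[OF assms] anchor_mono[of "graph_diameter V E" "Suc (graph_diameter V E)"]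
    by simp
qed

lemma level_le: "l v \<le> l (anchor (Suc i)) \<Longrightarrow> level v \<le> i"
  unfolding level_def by (rule Least_le)

lemma level_mono:
  assumes "v \<in> V" "l u \<le> l v"
  shows "level u \<le> level v"
  using le_anchor_Suc_level[OF assms(1)] assms(2) by (intro level_le) linarith

lemma anchor_less:
  assumes "0 < i" "i \<le> level v"
  shows "l (anchor i) < l v"
  \<comment> \<open>By minimality of the level, \<open>v\<close> is not weakly left of
    \<open>anchor (Suc (i - 1))\<close>, which is \<open>anchor i\<close> because \<open>i\<close>
    is positive.\<close>
  using level_le[of v "i - 1"] assms by fastforce

lemma anchor_level_le:
  assumes "v \<in> V"
  shows "l (anchor (level v)) \<le> l v"
  using anchor_less[of "level v" v] anchor_0_le[OF assms] by fastforce

text \<open>If the anchors stalled at \<open>i\<close>, none would ever get past that position, yet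
  \<open>v\<close> lies strictly beyond it and some anchor reaches \<open>v\<close>.\<close>

lemma anchor_strict:
  assumes "v \<in> V" "i < level v"
  shows "l (anchor i) < l (anchor (Suc i))"
proof (rule ccontr)
  assume "\<not> ?thesis"
  then have "l (anchor (Suc (level v))) \<le> l (anchor i)"
    using assms(2) anchor_stationary[of i "Suc (level v)"] by simp
  also have "\<dots> \<le> l (anchor (level v))"
    using assms(2) by (intro anchor_mono) simp
  also have "\<dots> < l v"
    using assms(2) by (intro anchor_less) auto
  finally show False using le_anchor_Suc_level[OF assms(1)] by simp
qed

lemma level_anchor_le: "level (anchor i) \<le> i"
  by (rule level_le) (simp add: anchor_mono)

text \<open>A smaller level would place \<open>anchor (Suc i)\<close> weakly left of
  \<open>anchor i\<close>, although the anchors still advance there.\<close>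

lemma level_anchor_Suc:
  assumes "v \<in> V" "i < level v"
  shows "level (anchor (Suc i)) = i"
proof (rule ccontr)
  define k where "k = level (anchor (Suc i))"
  assume "level (anchor (Suc i)) \<noteq> i"
  moreover have "k \<le> i" unfolding k_def by (rule level_le) simp
  ultimately have "Suc k \<le> i" by (simp add: k_def)
  then have "l (anchor (Suc i)) \<le> l (anchor i)"
    using le_anchor_Suc_level[OF anchor_in_V, of "Suc i"] anchor_mono[of "Suc k" i]
    by (simp add: k_def)
  with anchor_strict[OF assms] show False by simp
qed

text \<open>
  An anchor belongs to two consecutive cliques but has the level of the earlier one; taking the
  maximum gives its edges into the later clique the colour of that clique.
\<close>

definition colour :: "'a set \<Rightarrow> nat" where
  "colour e = Max (level ` e)"

lemma colour_edge: "colour {x, y} = max (level x) (level y)"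
  by (simp add: colour_def)

text \<open>Both vertices lie between the same two consecutive anchors, which are at most 1
  apart.\<close>

lemma same_level_adjacent:
  assumes "u \<in> V" "v \<in> V" "u \<noteq> v" "level u = level v"
  shows "{u, v} \<in> E"
proof -
  have "l (anchor (level v)) \<le> l u" "l u \<le> l (anchor (Suc (level v)))"
    using anchor_level_le[OF assms(1)] le_anchor_Suc_level[OF assms(1)] assms(4) by simp_all
  with anchor_level_le[OF assms(2)] le_anchor_Suc_level[OF assms(2)] anchor_Suc_le[of "level v"]
  have "\<bar>l u - l v\<bar> \<le> 1" by linarith
  then show ?thesis using edge_iff assms by blast
qed

section \<open>Rainbow paths along the anchors\<close>

text \<open>The path runs through the anchors from \<open>i\<close> to \<open>level v\<close> and
  then to \<open>v\<close>, with colours \<open>i\<close>, ..., \<open>level v\<close> in this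
  order. The last two conjuncts are the invariant that lets an earlier anchor be prepended without
  repeating a colour or a vertex. Positivity of \<open>level v\<close> keeps \<open>v\<close> apart
  from the last anchor.\<close>

lemma rainbow_path_from_anchor:
  assumes "v \<in> V" "0 < level v" "i \<le> level v"
  shows "\<exists>p. path_between V E (anchor i) p v \<and> distinct (map colour (path_edges p)) \<and>
    (\<forall>e\<in>set (path_edges p). i \<le> colour e) \<and> (\<forall>x\<in>set (tl p). l (anchor i) < l x)"
  using assms(3)
proof (induction i rule: inc_induct)
  case base
  let ?a = "anchor (level v)"
  have less: "l ?a < l v" using assms by (intro anchor_less) auto
  have "{?a, v} \<in> E"
  proof (subst edge_iff[OF anchor_in_V assms(1)])
    show "\<bar>l ?a - l v\<bar> \<le> 1"
      using less le_anchor_Suc_level[OF assms(1)] anchor_Suc_le[of "level v"] by linarith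
  qed (use less in auto)
  \<comment> \<open>An upper bound for the level of the anchor suffices, as the maximum is attained
    at \<open>v\<close>.\<close>
  moreover have "colour {?a, v} = level v"
    using level_anchor_le[of "level v"] by (simp add: colour_edge)
  ultimately show ?case
    using less assms(1) anchor_in_V
    by (intro exI[of _ "[?a, v]"]) (auto simp: path_between_def path_edges_Cons)
next
  case (step i)
  then obtain p where p: "path_between V E (anchor (Suc i)) p v"
    and rainbow: "distinct (map colour (path_edges p))"
    and colours: "\<forall>e\<in>set (path_edges p). Suc i \<le> colour e"
    and right: "\<forall>x\<in>set (tl p). l (anchor (Suc i)) < l x"
    by blast
  let ?a = "anchor i" and ?b = "anchor (Suc i)"
  have "i < level v" using step by simp
  note strict = anchor_strict[OF assms(1) this] and lev = level_anchor_Suc[OF assms(1) this]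
  have p': "p \<noteq> []" "hd p = ?b" "p = ?b # tl p"
    using p unfolding path_between_def by (simp_all, metis list.collapse)
  \<comment> \<open>This shows both that \<open>?a\<close> is new to the path and that the
    positional invariant persists.\<close>
  have above: "l ?a < l x" if "x \<in> set p" for x
    using that right strict p'(3) by (metis less_trans set_ConsD)
  have "{?a, ?b} \<in> E"
  proof (subst edge_iff[OF anchor_in_V anchor_in_V])
    show "\<bar>l ?a - l ?b\<bar> \<le> 1" using strict anchor_Suc_le[of i] by linarith
  qed (use strict in auto)
  then have "path_between V E ?a (?a # p) v"
    using p above anchor_in_V[of i] p'
    by (auto simp: path_between_def successively_Cons)
  moreover have "colour {?a, ?b} = i"
    using level_anchor_le[of i] lev by (simp add: colour_edge)
  ultimately show ?case
    using rainbow colours above p'(1,2)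
    by (intro exI[of _ "?a # p"]) (force simp: path_edges_Cons)
qed

text \<open>The edge from \<open>u\<close> to the right end of its own clique has colour
  \<open>level u\<close>, and the remaining path uses only larger colours.\<close>

lemma rainbow_path:
  assumes "u \<in> V" "v \<in> V" "level u < level v"
  shows "\<exists>p. path_between V E u p v \<and> distinct (map colour (path_edges p))"
proof -
  let ?b = "anchor (Suc (level u))"
  obtain p where p: "path_between V E ?b p v"
    and rainbow: "distinct (map colour (path_edges p))"
    and colours: "\<forall>e\<in>set (path_edges p). Suc (level u) \<le> colour e"
    and right: "\<forall>x\<in>set (tl p). l ?b < l x"
    using rainbow_path_from_anchor[OF assms(2), of "Suc (level u)"] assms(3) by auto
  show ?thesis
  \<comment> \<open>If \<open>u\<close> is itself that anchor, there is no edge to prepend.\<close>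
  proof (cases "u = ?b")
    case True
    with p rainbow show ?thesis by metis
  next
    case False
    have lev: "level ?b = level u" by (rule level_anchor_Suc[OF assms(2,3)])
    have p': "p \<noteq> []" "hd p = ?b" "p = ?b # tl p"
      using p unfolding path_between_def by (simp_all, metis list.collapse)
    have "u \<notin> set p"
      using False right p'(3) le_anchor_Suc_level[OF assms(1)] by (metis not_le set_ConsD)
    moreover have "{u, ?b} \<in> E"
      using same_level_adjacent[OF assms(1) anchor_in_V False] lev by simp
    ultimately have "path_between V E u (u # p) v"
      using p p' assms(1)
      by (auto simp: path_between_def successively_Cons)
    moreover have "distinct (map colour (path_edges (u # p)))"
      using rainbow colours p' lev
      by (force simp: path_edges_Cons colour_edge)
    ultimately show ?thesis by blast
  qed
qed

lemma rainbow_connected_colour: "rainbow_connected V E colour"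
  unfolding rainbow_connected_def
proof (intro ballI)
  fix u v assume uv: "u \<in> V" "v \<in> V"
  consider "u = v" | "u \<noteq> v" "level u = level v" | "level u < level v" | "level v < level u"
    by linarith
  then show "\<exists>p. path_between V E u p v \<and> distinct (map colour (path_edges p))"
  proof cases
    case 1
    then show ?thesis
      using uv by (intro exI[of _ "[u]"]) (auto simp: path_between_def path_edges_Cons)
  next
    case 2
    then show ?thesis
      using uv same_level_adjacent[OF uv]
      by (intro exI[of _ "[u, v]"]) (auto simp: path_between_def path_edges_Cons)
  next
    case 3
    then show ?thesis using rainbow_path uv by blast
  next
    case 4
    then obtain p where "path_between V E v p u" "distinct (map colour (path_edges p))"
      using rainbow_path uv by blast
    then show ?thesis
      by (intro exI[of _ "rev p"]) (simp add: path_between_rev path_edges_rev flip: rev_map)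
  qed
qed

section \<open>Counting the colours\<close>

lemma graph_diameter_pos:
  assumes "u \<in> V" "v \<in> V" "u \<noteq> v"
  shows "0 < graph_diameter V E"
proof -
  obtain p where p: "path_between V E u p v" "length (path_edges p) = graph_distance V E u v"
    using connected assms shortest_path_exists unfolding connected_graph_def by metis
  have "length (path_edges p) \<noteq> 0"
  proof
    assume "length (path_edges p) = 0"
    then have "hd p = last p"
      using p(1) by (cases p) (auto simp: length_path_edges path_between_def)
    with p(1) assms(3) show False by (metis path_between_def)
  qed
  with p(2) graph_distance_le_diameter[OF finite_V assms(1,2)] show ?thesis
    by (metis gr_zeroI le_zero_eq)
qed

lemma colour_less_diameter:
  assumes "e \<in> E"
  shows "colour e < graph_diameter V E"
proof -
  obtain u v where e: "e = {u, v}" "u \<noteq> v" and uv: "u \<in> V" "v \<in> V"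
    using assms simple unfolding simple_graph_def by (metis card_2_iff insert_subset)
  have pos: "0 < graph_diameter V E" by (rule graph_diameter_pos[OF uv e(2)])
  \<comment> \<open>All vertices lie weakly left of the anchor indexed by the diameter, which closes
    the level one below; positivity makes this predecessor genuine.\<close>
  have "level x < graph_diameter V E" if "x \<in> V" for x
    using level_le[of x "graph_diameter V E - 1"] le_anchor_diameter[OF that] pos
    by simp
  with uv show ?thesis by (simp add: e colour_edge)
qed

lemma card_colours_le_diameter: "card (colour ` E) \<le> graph_diameter V E"
proof -
  have "colour ` E \<subseteq> {..<graph_diameter V E}" using colour_less_diameter by auto
  from card_mono[OF _ this] show ?thesis by simp
qed

theorem rainbow_connection_number_eq_diameter:
  "rainbow_connection_number V E = graph_diameter V E"
  by (rule rainbow_connection_number_eqI)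
    (rule simple V_nonempty rainbow_connected_colour card_colours_le_diameter)+

end

theorem theorem4:
  fixes V :: "'a set" and E :: "'a set set"
  assumes "unit_interval_graph V E"
    and "connected_graph V E"
    and "minimum_degree V E \<ge> 2"
  shows "rainbow_connection_number V E = graph_diameter V E"
proof -
  obtain l :: "'a \<Rightarrow> real" where simple: "simple_graph V E"
    and l: "\<And>u v. u \<in> V \<Longrightarrow> v \<in> V \<Longrightarrow> u \<noteq> v \<Longrightarrow>
      {u, v} \<in> E \<longleftrightarrow> {l u..l u + 1} \<inter> {l v..l v + 1} \<noteq> {}"
    using assms(1) unfolding unit_interval_graph_def by blast
  have "{l u..l u + 1} \<inter> {l v..l v + 1} \<noteq> {} \<longleftrightarrow> \<bar>l u - l v\<bar> \<le> 1" for u v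
    by (auto simp: abs_le_iff)
  then interpret unit_interval_model V E l
    using simple assms(2) l by unfold_locales auto
  show ?thesis by (rule rainbow_connection_number_eq_diameter)
qed

end
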